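(* Let $k\geq 1$ and $n$ be integers with $n+1>2k$. Then $\mathrm{Det}(K_{n+1:k})=n+1-k$ if and only if the Kneser graph $K_{n+1:k}$ is isomorphic to $K_{n+1:1}$, $K_{5:2}$ or $K_{6:2}$.
   Context: For positive integers $N,k$, the Kneser graph $K_{N:k}$ has as vertices the $k$-element subsets of $[N]=\{1,\ldots,N\}$, two vertices being adjacent exactly when they are disjoint as sets. A set $S\subseteq V(G)$ of vertices of a finite graph $G$ is a determining set of $G$ if whenever $g,h\in\mathrm{Aut}(G)$ satisfy $g(s)=h(s)$ for all $s\in S$, then $g(v)=h(v)$ for all $v\in V(G)$. The determining number $\mathrm{Det}(G)$ is the minimum cardinality of a determining set of $G$. *)

theory Defs
  imports "Graph_Theory.Pair_Digraph" "Graph_Theory.Digraph_Isomorphism"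
begin

text \<open>
  A finite simple graph is represented as a symmetric loop-free digraph (locale
  \<open>pair_graph\<close>): each undirected edge contributes both of its orientations to \<open>parcs\<close>.
\<close>

definition kneser_graph :: "nat \<Rightarrow> nat \<Rightarrow> nat set pair_pre_digraph" where
  "kneser_graph N k =
    \<lparr> pverts = {A. A \<subseteq> {1..N} \<and> card A = k},
      parcs = {(A, B). A \<subseteq> {1..N} \<and> card A = k \<and> B \<subseteq> {1..N} \<and> card B = k \<and> A \<inter> B = {}} \<rparr>"

abbreviation graph_isomorphic :: "'a pair_pre_digraph \<Rightarrow> 'b pair_pre_digraph \<Rightarrow> bool" where
  "graph_isomorphic G H \<equiv> digraph_iso (with_proj G) (with_proj H)"

text \<open>
  Automorphisms are taken as maps on vertices; arcs being pairs of vertices, the action on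
  arcs is determined by the one on vertices. Values outside \<open>pverts G\<close> are irrelevant.
\<close>

definition graph_automorphisms :: "'a pair_pre_digraph \<Rightarrow> ('a \<Rightarrow> 'a) set" where
  "graph_automorphisms G =
    {iso_verts f | f. pre_digraph.digraph_isomorphism (with_proj G) f \<and>
                      app_iso f (with_proj G) = with_proj G}"

definition determining_set :: "'a pair_pre_digraph \<Rightarrow> 'a set \<Rightarrow> bool" where
  "determining_set G S \<longleftrightarrow> S \<subseteq> pverts G \<and>
    (\<forall>g\<in>graph_automorphisms G. \<forall>h\<in>graph_automorphisms G.
       (\<forall>s\<in>S. g s = h s) \<longrightarrow> (\<forall>v\<in>pverts G. g v = h v))"

definition determining_number :: "'a pair_pre_digraph \<Rightarrow> nat" where
  "determining_number G = (LEAST m. \<exists>S. finite S \<and> determining_set G S \<and> card S = m)"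

lemma pair_graph_kneser_graph:
  assumes "k \<ge> 1"
  shows "pair_graph (kneser_graph N k)"
proof -
  have fin: "finite (pverts (kneser_graph N k))"
    by (rule finite_subset[of _ "Pow {1..N}"]) (auto simp: kneser_graph_def)
  have "parcs (kneser_graph N k) \<subseteq> pverts (kneser_graph N k) \<times> pverts (kneser_graph N k)"
    by (auto simp: kneser_graph_def)
  then have "finite (parcs (kneser_graph N k))"
    using fin by (meson finite_SigmaI finite_subset)
  moreover have "symmetric (with_proj (kneser_graph N k))"
    by (auto simp: symmetric_def sym_def kneser_graph_def)
  moreover have "fst e \<in> pverts (kneser_graph N k)" "snd e \<in> pverts (kneser_graph N k)"
    if "e \<in> parcs (kneser_graph N k)" for e
    using that by (auto simp: kneser_graph_def)
  moreover have "fst e \<noteq> snd e" if "e \<in> parcs (kneser_graph N k)" for e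
  proof -
    have "card (fst e) = k" "fst e \<inter> snd e = {}"
      using that by (auto simp: kneser_graph_def)
    then show ?thesis using assms by auto
  qed
  ultimately show ?thesis
    using fin by (intro pair_graph.intro pair_digraph.intro pair_pseudo_graph.intro
        pair_fin_digraph.intro pair_fin_digraph_axioms.intro pair_wf_digraph.intro
        pair_loopfree_digraph.intro pair_loopfree_digraph_axioms.intro
        pair_sym_digraph.intro pair_sym_digraph_axioms.intro)
qed

lemma graph_automorphisms_iff:
  assumes "pair_wf_digraph G"
  shows "g \<in> graph_automorphisms G \<longleftrightarrow>
    bij_betw g (pverts G) (pverts G) \<and>
    (\<forall>u\<in>pverts G. \<forall>v\<in>pverts G. (g u, g v) \<in> parcs G \<longleftrightarrow> (u, v) \<in> parcs G)"
    (is "?L \<longleftrightarrow> ?R")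
proof -
  have sub: "parcs G \<subseteq> pverts G \<times> pverts G"
    using assms by (auto dest: pair_wf_digraph.arc_fst_in_verts pair_wf_digraph.arc_snd_in_verts)
  show ?thesis
  proof
    assume ?L
    then obtain f where g: "g = iso_verts f"
      and iso: "pre_digraph.digraph_isomorphism (with_proj G) f"
      and app: "app_iso f (with_proj G) = with_proj G"
      by (auto simp: graph_automorphisms_def)
    have V: "iso_verts f ` pverts G = pverts G" and A: "iso_arcs f ` parcs G = parcs G"
      and t: "iso_tail f = fst" and h: "iso_head f = snd"
      using app by (auto simp: app_iso_def with_proj_def)
    have inj: "inj_on g (pverts G)"
      using iso g by (simp add: pre_digraph.digraph_isomorphism_def)
    have arc: "iso_arcs f e = (g (fst e), g (snd e))" if "e \<in> parcs G" for e
      using iso that g t h by (simp add: pre_digraph.digraph_isomorphism_def prod_eq_iff)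
    have "(g u, g v) \<in> parcs G \<longleftrightarrow> (u, v) \<in> parcs G" if "u \<in> pverts G" "v \<in> pverts G" for u v
    proof
      assume "(u, v) \<in> parcs G"
      then show "(g u, g v) \<in> parcs G" by (metis A arc fst_conv imageI snd_conv)
    next
      assume "(g u, g v) \<in> parcs G"
      then obtain e where e: "e \<in> parcs G" "(g u, g v) = iso_arcs f e" using A by blast
      then have "g u = g (fst e)" "g v = g (snd e)" using arc by auto
      moreover have "fst e \<in> pverts G" "snd e \<in> pverts G"
        using sub e(1) by (auto simp: mem_Times_iff)
      ultimately have "u = fst e" "v = snd e" using inj that by (auto dest: inj_onD)
      with e(1) show "(u, v) \<in> parcs G" by simp
    qed
    with V inj g show ?R by (auto simp: bij_betw_def)
  next
    assume R: ?R
    let ?f = "\<lparr>iso_verts = g, iso_arcs = map_prod g g, iso_head = snd, iso_tail = fst\<rparr>"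
    have V: "g ` pverts G = pverts G" and inj: "inj_on g (pverts G)"
      using R by (auto simp: bij_betw_def)
    have A: "map_prod g g ` parcs G = parcs G"
    proof
      show "map_prod g g ` parcs G \<subseteq> parcs G" using R sub by auto
    next
      show "parcs G \<subseteq> map_prod g g ` parcs G"
      proof
        fix e assume e: "e \<in> parcs G"
        then have "fst e \<in> g ` pverts G" "snd e \<in> g ` pverts G"
          using sub unfolding V by (auto simp: mem_Times_iff)
        then obtain u v where uv: "u \<in> pverts G" "v \<in> pverts G" "e = (g u, g v)"
          by (metis imageE prod.collapse)
        with e R have "(u, v) \<in> parcs G" by simp
        then show "e \<in> map_prod g g ` parcs G"
          unfolding uv(3) by (metis image_eqI map_prod_simp)
      qed
    qed
    have "inj_on (map_prod g g) (parcs G)"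
      using map_prod_inj_on[OF inj inj] sub by (rule inj_on_subset)
    then have "pre_digraph.digraph_isomorphism (with_proj G) ?f"
      using inj assms by (simp add: pre_digraph.digraph_isomorphism_def wf_digraph_wp_iff)
    moreover have "app_iso ?f (with_proj G) = with_proj G"
      using V A by (simp add: app_iso_def with_proj_def)
    moreover have "g = iso_verts ?f" by simp
    ultimately show ?L unfolding graph_automorphisms_def by blast
  qed
qed

end

theory Submission
  imports Defs "HOL-Library.Ramsey" "HOL-Combinatorics.Transposition"
begin

text \<open>
  Write \<open>N = n + 1\<close>. Every permutation of \<open>{1..N}\<close> acts on the Kneser graph, and as \<open>2 * k < N\<close>
  there are no other automorphisms (\<open>kneser_automorphism_induced\<close>). So a family of \<open>k\<close>-sets is
  determining exactly when no two points of \<open>{1..N}\<close> lie in the same members of the family, and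
  the determining number is the least size \<open>m\<close> of such a separating family.

  That all automorphisms are permutations is shown without the theory of maximum intersecting
  families. The number of common neighbours of two \<open>k\<close>-sets reveals whether they differ in just one
  element, so an automorphism of the Kneser graph is one of the Johnson graph. There, the
  \<open>k\<close>-sets containing a fixed \<open>(k - 1)\<close>-set form a clique with \<open>N - k + 1\<close> members; all
  cliques not of this form or part of one live inside a \<open>(k + 1)\<close>-set, and they have at most \<open>k + 1 < N - k + 1\<close>
  members. Hence the automorphism permutes the cliques of the first kind, that is, the
  \<open>(k - 1)\<close>-sets, and this is an automorphism of the next smaller Johnson graph. Descending to
  \<open>k = 1\<close> yields a permutation of the points.

  It remains to compare \<open>m\<close> with \<open>N - k\<close>. Counting incidences gives
  \<open>2 * N \<le> m * (k + 1) + 2\<close> (\<open>separating_family_lower_bound\<close>), which forces \<open>m \<ge> N - k\<close> for \<open>k = 1\<close>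
  and for \<open>(N, k) = (5, 2)\<close> and \<open>(6, 2)\<close>. In these cases families with \<open>N - k\<close> members exist; in all
  others \<open>N - k - 1\<close> sets suffice (\<open>separating_family_small\<close>): families on \<open>7\<close> points, for \<open>k = 2\<close>
  and \<open>k = 3\<close>, are enlarged by one set at a time, along with one new point, or with two new points
  and \<open>k\<close> increased by one, both of which preserve \<open>m = N - k - 1\<close>.

  Finally, the exceptional isomorphism types are recognised by their number of vertices alone:
  for \<open>k \<ge> 2\<close> and \<open>N \<ge> 7\<close> the binomial coefficient exceeds \<open>N\<close> and is at least \<open>21\<close>.
\<close>

section \<open>Subsets at Johnson distance one\<close>

lemma nsets_iff:
  assumes "finite X"
  shows "A \<in> nsets X k \<longleftrightarrow> A \<subseteq> X \<and> card A = k"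
  using assms by (auto simp: nsets_def intro: finite_subset)

lemma card_nsets:
  assumes "finite X"
  shows "card (nsets X k) = card X choose k"
proof -
  have "nsets X k = {A. A \<subseteq> X \<and> card A = k}" using nsets_iff[OF assms] by blast
  then show ?thesis using n_subsets[OF assms] by simp
qed

lemma card_Un_gt:
  assumes "A \<in> nsets X k" "B \<in> nsets X k" "A \<noteq> B"
  shows "k < card (A \<union> B)"
proof (rule ccontr)
  assume "\<not> ?thesis"
  then have le: "card (A \<union> B) \<le> card A" "card (A \<union> B) \<le> card B" and "finite A" "finite B"
    using assms by (auto simp: nsets_def)
  then have "A = A \<union> B" "B = A \<union> B"
    using card_seteq[OF _ Un_upper1 le(1)] card_seteq[OF _ Un_upper2 le(2)] by auto
  then show False using assms(3) by blast
qed

text \<open>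
  Two members \<open>A1\<close> and \<open>A2\<close> meet in a \<open>k\<close>-set \<open>I\<close> and span a \<open>(k + 2)\<close>-set \<open>U\<close>. A member missing a
  point of \<open>I\<close> must be \<open>U\<close> without that point. There are only \<open>k + 2\<close> sets of the right size
  inside \<open>U\<close>, so the clique has a member that leaves \<open>U\<close>; it contains \<open>I\<close> and is too far from every
  set of the form \<open>U - {i}\<close> with \<open>i \<in> I\<close>, so no such set belongs to the clique.
\<close>

lemma large_clique_has_core:
  assumes fin: "finite X" and F: "F \<subseteq> nsets X (Suc k)"
    and adj: "\<And>A B. A \<in> F \<Longrightarrow> B \<in> F \<Longrightarrow> A \<noteq> B \<Longrightarrow> card (A \<union> B) = Suc (Suc k)"
    and large: "card F > Suc (Suc k)"
  shows "\<exists>I\<in>nsets X k. \<forall>A\<in>F. I \<subseteq> A"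
proof -
  have A: "A \<subseteq> X" "card A = Suc k" "finite A" if "A \<in> F" for A
    using that F by (auto simp: nsets_def)
  have int: "card (A \<inter> B) = k" if "A \<in> F" "B \<in> F" "A \<noteq> B" for A B
    using card_Un_Int[OF A(3) A(3), OF that(1,2)] A(2)[OF that(1)] A(2)[OF that(2)] adj[OF that]
    by simp
  have "\<not> card F \<le> Suc 0" "finite F"
    using large by (auto intro: card_ge_0_finite)
  then obtain A1 A2 where A12: "A1 \<in> F" "A2 \<in> F" "A1 \<noteq> A2"
    by (meson card_le_Suc0_iff_eq)
  define I where "I = A1 \<inter> A2"
  define U where "U = A1 \<union> A2"
  have I: "card I = k" and U: "card U = Suc (Suc k)" "finite U"
    using int adj A12 A by (auto simp: I_def U_def)
  have miss: "A = U - {i}" if "A \<in> F" "i \<in> I" "i \<notin> A" for A i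
  proof -
    have "A' - {i} \<subseteq> A" if "A' \<in> F" "i \<in> A'" for A'
    proof -
      have "A \<noteq> A'" using that \<open>i \<notin> A\<close> by auto
      then have "card (A \<inter> A') = card (A' - {i})"
        using int[OF \<open>A \<in> F\<close>] A(2) that by simp
      moreover have "A \<inter> A' \<subseteq> A' - {i}" using \<open>i \<notin> A\<close> by auto
      ultimately have "A \<inter> A' = A' - {i}"
        using A(3)[OF that(1)] by (intro card_subset_eq) auto
      then show ?thesis by blast
    qed
    then have "U - {i} \<subseteq> A" using A12 \<open>i \<in> I\<close> by (auto simp: U_def I_def)
    moreover have "card (U - {i}) = card A"
      using U A(2) that by (simp add: U_def I_def)
    ultimately show ?thesis using A(3)[OF that(1)] by (metis card_subset_eq)
  qed
  have "\<exists>A3\<in>F. \<not> A3 \<subseteq> U"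
  proof (rule ccontr)
    assume "\<not> ?thesis"
    then have "F \<subseteq> nsets U (Suc k)" using A by (auto simp: nsets_def)
    then have "card F \<le> Suc (Suc k) choose Suc k"
      using card_nsets[OF U(2)] U card_mono finite_imp_finite_nsets by metis
    then show False using large by (simp add: binomial_Suc_n)
  qed
  then obtain A3 c where A3: "A3 \<in> F" "c \<in> A3" "c \<notin> U" by blast
  have IA3: "I \<subseteq> A3" using miss[OF A3(1)] A3 by blast
  have "I \<subseteq> A" if "A \<in> F" for A
  proof (rule ccontr)
    assume "\<not> I \<subseteq> A"
    then obtain i where i: "i \<in> I" "i \<notin> A" by blast
    have "A = U - {i}" using miss that i by blast
    moreover have "i \<in> A3" using i IA3 by blast
    ultimately have "insert c U \<subseteq> A \<union> A3" "A \<noteq> A3" using A3 i by auto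
    then have "card (insert c U) \<le> Suc (Suc k)"
      using adj[OF that A3(1)] A(3)[OF that] A(3)[OF A3(1)] by (metis card_mono finite_UnI)
    then show False using U A3 by simp
  qed
  moreover have "I \<in> nsets X k" using I A(1)[OF A12(1)] fin by (auto simp: nsets_iff I_def)
  ultimately show ?thesis by blast
qed

text \<open>
  The cliques of the Johnson graph on \<open>(k + 1)\<close>-sets that stand for its \<open>k\<close>-sets.
\<close>

definition star :: "'a set \<Rightarrow> nat \<Rightarrow> 'a set \<Rightarrow> 'a set set" where
  "star X k B = {A \<in> nsets X (Suc k). B \<subseteq> A}"

lemma star_eq_insert:
  assumes "finite X" "B \<in> nsets X k"
  shows "star X k B = (\<lambda>x. insert x B) ` (X - B)"
proof
  have B: "B \<subseteq> X" "card B = k" "finite B" using assms by (auto simp: nsets_def)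
  show "star X k B \<subseteq> (\<lambda>x. insert x B) ` (X - B)"
  proof
    fix A assume "A \<in> star X k B"
    then have A: "A \<subseteq> X" "card A = Suc k" "B \<subseteq> A" "finite A" by (auto simp: star_def nsets_def)
    then have "card (A - B) = 1" using B by (simp add: card_Diff_subset)
    then obtain x where "A - B = {x}" by (rule card_1_singletonE)
    then show "A \<in> (\<lambda>x. insert x B) ` (X - B)" using A by blast
  qed
  show "(\<lambda>x. insert x B) ` (X - B) \<subseteq> star X k B"
    using B by (auto simp: star_def nsets_def)
qed

lemma card_star:
  assumes "finite X" "B \<in> nsets X k"
  shows "card (star X k B) = card X - k"
proof -
  have B: "B \<subseteq> X" "card B = k" "finite B" using assms by (auto simp: nsets_def)
  have "inj_on (\<lambda>x. insert x B) (X - B)" by (auto simp: inj_on_def)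
  then show ?thesis using B by (simp add: star_eq_insert[OF assms] card_image card_Diff_subset)
qed

lemma star_eq_iff:
  assumes "finite X" "Suc k < card X" "B \<in> nsets X k" "B' \<in> nsets X k"
  shows "star X k B = star X k B' \<longleftrightarrow> B = B'"
proof
  assume eq: "star X k B = star X k B'"
  have B: "B \<subseteq> X" "card B = k" "finite B" "card B' = k" using assms by (auto simp: nsets_def)
  have "B' \<subseteq> B"
  proof
    fix x assume x: "x \<in> B'"
    show "x \<in> B"
    proof (rule ccontr)
      assume "x \<notin> B"
      have "\<not> X \<subseteq> insert x B"
        using card_mono[of "insert x B" X] B assms(2) \<open>x \<notin> B\<close> by auto
      then obtain y where y: "y \<in> X" "y \<notin> insert x B" by blast
      then have "insert y B \<in> star X k B'"
        using star_eq_insert[OF assms(1,3)] eq by blast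
      then show False using x y \<open>x \<notin> B\<close> by (auto simp: star_def)
    qed
  qed
  then show "B = B'" using B by (metis card_subset_eq)
qed simp

text \<open>
  Adjacency of \<open>k\<close>-sets is thereby expressed through the stars, on which a map of
  \<open>(k + 1)\<close>-sets acts. This is what makes the descent from \<open>k + 1\<close> to \<open>k\<close> possible.
\<close>

lemma adjacent_iff_stars_meet:
  assumes "finite X" "B \<in> nsets X k" "B' \<in> nsets X k"
  shows "card (B \<union> B') = Suc k \<longleftrightarrow> B \<noteq> B' \<and> star X k B \<inter> star X k B' \<noteq> {}"
proof
  assume c: "card (B \<union> B') = Suc k"
  then have "B \<union> B' \<in> star X k B \<inter> star X k B'"
    using assms by (auto simp: star_def nsets_def)
  moreover have "B \<noteq> B'" using c assms by (auto simp: nsets_def)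
  ultimately show "B \<noteq> B' \<and> star X k B \<inter> star X k B' \<noteq> {}" by blast
next
  assume r: "B \<noteq> B' \<and> star X k B \<inter> star X k B' \<noteq> {}"
  then obtain A where "B \<union> B' \<subseteq> A" "card A = Suc k" "finite A"
    by (auto simp: star_def nsets_def)
  then have "card (B \<union> B') \<le> Suc k" by (metis card_mono)
  moreover have fin: "finite B" "finite B'" "card B = k" "card B' = k"
    using assms by (auto simp: nsets_def)
  moreover have "k < card (B \<union> B')" using card_Un_gt[OF assms(2,3)] r by blast
  ultimately show "card (B \<union> B') = Suc k" by simp
qed

section \<open>Automorphisms are induced by permutations of the ground set\<close>

text \<open>
  The size of the ground set enters through the cliques: the image of a star is a clique with
  \<open>card X - k\<close> members, which is too many for it to sit inside a single set of size \<open>k + 2\<close>, so it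
  is a star again. The induced map \<open>h\<close> on smaller sets comes from a permutation by induction, and
  \<open>g\<close> follows it because a set with at least two elements is the union of its subsets with one
  element removed.
\<close>

lemma johnson_automorphism_induced:
  assumes fin: "finite X" and big: "2 * Suc j < card X"
    and inj: "inj_on g (nsets X (Suc j))" and into: "g ` nsets X (Suc j) \<subseteq> nsets X (Suc j)"
    and adj: "\<And>A B. A \<in> nsets X (Suc j) \<Longrightarrow> B \<in> nsets X (Suc j) \<Longrightarrow>
      card (g A \<union> g B) = Suc (Suc j) \<longleftrightarrow> card (A \<union> B) = Suc (Suc j)"
  shows "\<exists>\<sigma>. bij_betw \<sigma> X X \<and> (\<forall>A\<in>nsets X (Suc j). g A = \<sigma> ` A)"
  using big inj into adj
proof (induction j arbitrary: g)
  case 0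
  have "\<forall>x\<in>X. \<exists>y\<in>X. g {x} = {y}"
    using "0.prems"(3) by (force simp: nsets_one)
  then obtain \<sigma> where \<sigma>: "\<And>x. x \<in> X \<Longrightarrow> \<sigma> x \<in> X \<and> g {x} = {\<sigma> x}" by metis
  have "inj_on \<sigma> X"
  proof (rule inj_onI)
    fix x y assume xy: "x \<in> X" "y \<in> X" "\<sigma> x = \<sigma> y"
    then have "g {x} = g {y}" using \<sigma> by simp
    then show "x = y" using inj_onD[OF "0.prems"(2), of "{x}" "{y}"] xy by (simp add: nsets_one)
  qed
  then have "bij_betw \<sigma> X X"
    using \<sigma> fin by (simp add: bij_betw_def endo_inj_surj image_subsetI)
  then show ?case using \<sigma> by (intro exI[of _ \<sigma>]) (auto simp: nsets_one)
next
  case (Suc j)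
  let ?k = "Suc j"
  let ?S = "star X ?k"
  have sub: "?S B \<subseteq> nsets X (Suc ?k)" for B by (auto simp: star_def)
  have cardS: "card (?S B) = card X - ?k" if "B \<in> nsets X ?k" for B
    using card_star[OF fin that] .
  have ex: "\<exists>I\<in>nsets X ?k. \<forall>A\<in>g ` ?S B. I \<subseteq> A" if B: "B \<in> nsets X ?k" for B
  proof (rule large_clique_has_core[OF fin])
    show "g ` ?S B \<subseteq> nsets X (Suc ?k)" using sub[of B] Suc.prems(3) by blast
    have "card (g ` ?S B) = card X - ?k"
      using cardS[OF B] card_image[OF inj_on_subset[OF Suc.prems(2) sub]] by simp
    then show "card (g ` ?S B) > Suc (Suc ?k)" using Suc.prems(1) by simp
    fix A A' assume "A \<in> g ` ?S B" "A' \<in> g ` ?S B" "A \<noteq> A'"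
    then obtain C C' where C: "A = g C" "A' = g C'" "C \<in> ?S B" "C' \<in> ?S B" "C \<noteq> C'" by auto
    then obtain x y where xy: "x \<in> X - B" "y \<in> X - B" "C = insert x B" "C' = insert y B"
      using star_eq_insert[OF fin B] by auto
    then have "C \<union> C' = insert x (insert y B)" "x \<noteq> y" using C(5) by auto
    then have "card (C \<union> C') = Suc (Suc ?k)" using xy B by (simp add: nsets_def)
    then show "card (A \<union> A') = Suc (Suc ?k)" using Suc.prems(4) C sub by blast
  qed
  then obtain h where h: "\<And>B. B \<in> nsets X ?k \<Longrightarrow> h B \<in> nsets X ?k"
    and hg: "\<And>B A. B \<in> nsets X ?k \<Longrightarrow> A \<in> ?S B \<Longrightarrow> h B \<subseteq> g A"
    by (metis imageI)
  have gS: "g ` ?S B = ?S (h B)" if B: "B \<in> nsets X ?k" for B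
  proof (rule card_subset_eq)
    show "finite (?S (h B))" using sub finite_imp_finite_nsets[OF fin] by (rule finite_subset)
    show "g ` ?S B \<subseteq> ?S (h B)"
      using hg[OF B] Suc.prems(3) by (fastforce simp: star_def)
    show "card (g ` ?S B) = card (?S (h B))"
      using cardS[OF B] cardS[OF h[OF B]] card_image[OF inj_on_subset[OF Suc.prems(2) sub]] by simp
  qed
  have h_eq: "h B = h B' \<longleftrightarrow> B = B'" if "B \<in> nsets X ?k" "B' \<in> nsets X ?k" for B B'
  proof -
    have "h B = h B' \<longleftrightarrow> g ` ?S B = g ` ?S B'"
      using star_eq_iff[OF fin _ h h] that gS Suc.prems(1) by simp
    also have "\<dots> \<longleftrightarrow> ?S B = ?S B'" by (rule inj_on_image_eq_iff[OF Suc.prems(2) sub sub])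
    also have "\<dots> \<longleftrightarrow> B = B'" using star_eq_iff[OF fin] that Suc.prems(1) by simp
    finally show ?thesis .
  qed
  have "\<exists>\<sigma>. bij_betw \<sigma> X X \<and> (\<forall>B\<in>nsets X ?k. h B = \<sigma> ` B)"
  proof (rule Suc.IH)
    show "2 * ?k < card X" using Suc.prems(1) by simp
    show "inj_on h (nsets X ?k)" using h_eq by (simp add: inj_on_def)
    show "h ` nsets X ?k \<subseteq> nsets X ?k" using h by blast
    fix B B' assume B: "B \<in> nsets X ?k" "B' \<in> nsets X ?k"
    have "?S (h B) \<inter> ?S (h B') = g ` (?S B \<inter> ?S B')"
      using inj_on_image_Int[OF Suc.prems(2) sub sub] gS B by metis
    then show "card (h B \<union> h B') = Suc ?k \<longleftrightarrow> card (B \<union> B') = Suc ?k"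
      using adjacent_iff_stars_meet[OF fin] B h h_eq by auto
  qed
  then obtain \<sigma> where \<sigma>: "bij_betw \<sigma> X X" and h\<sigma>: "\<And>B. B \<in> nsets X ?k \<Longrightarrow> h B = \<sigma> ` B" by blast
  have "g A = \<sigma> ` A" if A: "A \<in> nsets X (Suc ?k)" for A
  proof -
    have fA: "finite A" "A \<subseteq> X" "card A = Suc ?k" using A by (auto simp: nsets_def)
    have gA: "finite (g A)" "card (g A) = Suc ?k" using A Suc.prems(3) by (auto simp: nsets_def)
    have "\<sigma> ` A \<subseteq> g A"
    proof
      fix z assume "z \<in> \<sigma> ` A"
      then obtain x where x: "x \<in> A" "z = \<sigma> x" by blast
      have "A - {x} \<noteq> {}"
      proof
        assume "A - {x} = {}"
        then have "card (A - {x}) = 0" by (simp only: card.empty)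
        then show False using fA x by simp
      qed
      then obtain y where y: "y \<in> A" "y \<noteq> x" by blast
      have B: "A - {y} \<in> nsets X ?k" using fA y by (auto simp: nsets_def)
      then have "\<sigma> ` (A - {y}) \<subseteq> g A"
        using hg[OF B, of A] h\<sigma>[OF B] A by (auto simp: star_def)
      then show "z \<in> g A" using x y by blast
    qed
    moreover have "card (\<sigma> ` A) = Suc ?k"
      using card_image[OF inj_on_subset[OF bij_betw_imp_inj_on[OF \<sigma>] fA(2)]] fA by simp
    ultimately show ?thesis using gA by (metis card_subset_eq)
  qed
  then show ?case using \<sigma> by blast
qed

lemma verts_kneser: "pverts (kneser_graph N k) = nsets {1..N} k"
  by (simp add: kneser_graph_def nsets_iff set_eq_iff)

lemma arcs_kneser:
  "(A, B) \<in> parcs (kneser_graph N k) \<longleftrightarrow> A \<in> nsets {1..N} k \<and> B \<in> nsets {1..N} k \<and> A \<inter> B = {}"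
  by (auto simp: kneser_graph_def nsets_iff simp del: atLeastAtMost_iff)

lemma automorphism_kneser_iff:
  assumes "k \<ge> 1"
  shows "g \<in> graph_automorphisms (kneser_graph N k) \<longleftrightarrow>
    bij_betw g (nsets {1..N} k) (nsets {1..N} k) \<and>
    (\<forall>A\<in>nsets {1..N} k. \<forall>B\<in>nsets {1..N} k. g A \<inter> g B = {} \<longleftrightarrow> A \<inter> B = {})"
proof -
  interpret pair_graph "kneser_graph N k" by (rule pair_graph_kneser_graph[OF assms])
  show ?thesis
    unfolding graph_automorphisms_iff[OF pair_wf_digraph_axioms] verts_kneser arcs_kneser
    using bij_betwE[of g "nsets {1..N} k" "nsets {1..N} k"] by meson
qed

text \<open>
  The common neighbours are the \<open>k\<close>-subsets of the complement of \<open>A \<union> B\<close>. Their number drops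
  strictly when the union grows from \<open>k + 1\<close> elements to more, because the complement of a set of
  size \<open>k + 1\<close> still has at least \<open>k\<close> elements. For large unions the count may be constantly
  \<open>0\<close>; so it reveals nearest pairs but not all intersection sizes.
\<close>

lemma common_neighbours_iff:
  assumes "finite X" "k \<ge> 1" "2 * k < card X" "A \<in> nsets X k" "B \<in> nsets X k"
  shows "card (A \<union> B) = Suc k \<longleftrightarrow>
    A \<noteq> B \<and> card {C \<in> nsets X k. A \<inter> C = {} \<and> B \<inter> C = {}} = (card X - Suc k) choose k"
proof -
  let ?u = "card (A \<union> B)"
  have fin: "finite A" "finite B" "A \<subseteq> X" "B \<subseteq> X" "card A = k" "card B = k"
    using assms by (auto simp: nsets_def)
  have "{C \<in> nsets X k. A \<inter> C = {} \<and> B \<inter> C = {}} = nsets (X - (A \<union> B)) k"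
    by (auto simp: nsets_def)
  then have count: "card {C \<in> nsets X k. A \<inter> C = {} \<and> B \<inter> C = {}} = (card X - ?u) choose k"
    using fin assms(1) by (simp add: card_nsets card_Diff_subset)
  have "?u > k" if "A \<noteq> B" using card_Un_gt[OF assms(4,5) that] .
  moreover have "(card X - ?u) choose k < (card X - Suc k) choose k" if "?u > Suc k"
  proof -
    obtain m where m: "card X - Suc k = Suc m" "m \<ge> k - 1"
      using assms by (cases "card X - Suc k") auto
    obtain i where i: "k = Suc i" using assms(2) by (cases k) auto
    have "(card X - ?u) choose k \<le> m choose k"
      using that m by (intro binomial_right_mono) simp
    also have "m choose k < Suc m choose k" using m i by simp
    finally show ?thesis using m by simp
  qed
  moreover have "A \<noteq> B" if "?u = Suc k" using that fin by auto
  ultimately show ?thesis unfolding count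
    by (metis Suc_lessI less_irrefl)
qed

lemma kneser_automorphism_induced:
  assumes k: "k \<ge> 1" and N: "2 * k < N" and g: "g \<in> graph_automorphisms (kneser_graph N k)"
  shows "\<exists>\<sigma>. bij_betw \<sigma> {1..N} {1..N} \<and> (\<forall>A\<in>nsets {1..N} k. g A = \<sigma> ` A)"
proof -
  let ?V = "nsets {1..N} k"
  have bij: "bij_betw g ?V ?V"
    and disj: "\<And>A B. A \<in> ?V \<Longrightarrow> B \<in> ?V \<Longrightarrow> g A \<inter> g B = {} \<longleftrightarrow> A \<inter> B = {}"
    using g automorphism_kneser_iff[OF k] by auto
  have inj: "inj_on g ?V" and im: "g ` ?V = ?V" using bij by (auto simp: bij_betw_def)
  have gV: "g A \<in> ?V" if "A \<in> ?V" for A using that im by blast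
  have adj: "card (g A \<union> g B) = Suc k \<longleftrightarrow> card (A \<union> B) = Suc k" if "A \<in> ?V" "B \<in> ?V" for A B
  proof -
    have "{C \<in> ?V. g A \<inter> C = {} \<and> g B \<inter> C = {}} = {C \<in> g ` ?V. g A \<inter> C = {} \<and> g B \<inter> C = {}}"
      by (simp only: im)
    also have "\<dots> = g ` {C \<in> ?V. g A \<inter> g C = {} \<and> g B \<inter> g C = {}}" by blast
    also have "\<dots> = g ` {C \<in> ?V. A \<inter> C = {} \<and> B \<inter> C = {}}"
      using disj that by (simp cong: conj_cong)
    finally have "{C \<in> ?V. g A \<inter> C = {} \<and> g B \<inter> C = {}} = \<dots>" .
    moreover have "inj_on g {C \<in> ?V. A \<inter> C = {} \<and> B \<inter> C = {}}"
      using inj by (rule inj_on_subset) auto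
    ultimately have "card {C \<in> ?V. g A \<inter> C = {} \<and> g B \<inter> C = {}} = card {C \<in> ?V. A \<inter> C = {} \<and> B \<inter> C = {}}"
      by (simp add: card_image)
    moreover have "g A = g B \<longleftrightarrow> A = B" using inj that by (simp add: inj_on_eq_iff)
    ultimately show ?thesis
      using common_neighbours_iff[of "{1..N}" k] k N gV that by simp
  qed
  obtain j where j: "k = Suc j" using k by (cases k) auto
  show ?thesis
    using johnson_automorphism_induced[of "{1..N}" j g] adj inj im N unfolding j by simp
qed

lemma permutation_induces_automorphism:
  assumes "k \<ge> 1" "bij_betw \<sigma> {1..N} {1..N}"
  shows "(`) \<sigma> \<in> graph_automorphisms (kneser_graph N k)"
  unfolding automorphism_kneser_iff[OF assms(1)]
proof (intro conjI ballI)
  show "bij_betw ((`) \<sigma>) (nsets {1..N} k) (nsets {1..N} k)"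
    by (rule bij_betw_nsets[OF assms(2)])
  fix A B assume "A \<in> nsets {1..N} k" "B \<in> nsets {1..N} k"
  then have "\<sigma> ` A \<inter> \<sigma> ` B = \<sigma> ` (A \<inter> B)"
    using inj_on_image_Int[OF bij_betw_imp_inj_on[OF assms(2)], of A B] by (auto simp: nsets_def)
  then show "\<sigma> ` A \<inter> \<sigma> ` B = {} \<longleftrightarrow> A \<inter> B = {}" by auto
qed

section \<open>Determining sets are separating families\<close>

definition separates :: "'a set set \<Rightarrow> 'a set \<Rightarrow> bool" where
  "separates S X \<longleftrightarrow> (\<forall>x\<in>X. \<forall>y\<in>X. (\<forall>A\<in>S. x \<in> A \<longleftrightarrow> y \<in> A) \<longrightarrow> x = y)"

lemma separatesD:
  "separates S X \<Longrightarrow> x \<in> X \<Longrightarrow> y \<in> X \<Longrightarrow> (\<And>A. A \<in> S \<Longrightarrow> x \<in> A \<longleftrightarrow> y \<in> A) \<Longrightarrow> x = y"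
  unfolding separates_def by blast

text \<open>
  The transposition of two points that the family does not separate fixes each of its members, as
  does the identity, but moves a \<open>k\<close>-set containing exactly one of them.
\<close>

lemma determining_set_imp_separates:
  assumes k: "k \<ge> 1" and N: "k < N" and det: "determining_set (kneser_graph N k) S"
  shows "separates S {1..N}"
  unfolding separates_def
proof (intro ballI impI)
  fix x y assume xy: "x \<in> {1..N}" "y \<in> {1..N}" and same: "\<forall>A\<in>S. x \<in> A \<longleftrightarrow> y \<in> A"
  let ?t = "Transposition.transpose x y"
  show "x = y"
  proof (rule ccontr)
    assume ne: "x \<noteq> y"
    have "k - 1 \<le> card ({1..N} - {x, y})" using xy ne N by (simp add: card_Diff_subset)
    then obtain C where C: "C \<subseteq> {1..N} - {x, y}" "card C = k - 1" "finite C"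
      by (rule obtain_subset_with_card_n)
    have v: "insert x C \<in> nsets {1..N} k" using C xy k by (auto simp: nsets_def card_insert_if)
    have "bij_betw ?t {1..N} {1..N}"
      using xy by (simp add: bij_betw_def)
    then have t: "(`) ?t \<in> graph_automorphisms (kneser_graph N k)"
      by (rule permutation_induces_automorphism[OF k])
    have i: "(`) id \<in> graph_automorphisms (kneser_graph N k)"
      by (rule permutation_induces_automorphism[OF k]) simp
    have fixed: "\<forall>A\<in>S. ?t ` A = id ` A" using same by simp
    have all: "\<forall>g\<in>graph_automorphisms (kneser_graph N k). \<forall>h\<in>graph_automorphisms (kneser_graph N k).
        (\<forall>A\<in>S. g A = h A) \<longrightarrow> (\<forall>A\<in>nsets {1..N} k. g A = h A)"
      using det by (simp add: determining_set_def verts_kneser)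
    have "?t ` insert x C = id ` insert x C"
      using bspec[OF mp[OF bspec[OF bspec[OF all t] i] fixed] v] .
    moreover have "y \<in> ?t ` insert x C" by simp
    moreover have "y \<notin> id ` insert x C" using C ne by auto
    ultimately show False by blast
  qed
qed

text \<open>
  If \<open>\<sigma>\<close> and \<open>\<tau>\<close> induce two automorphisms that agree on the family, then \<open>x\<close> and the
  \<open>\<tau>\<close>-preimage of \<open>\<sigma> x\<close> lie in the same members, so they coincide.
\<close>

lemma separates_imp_determining_set:
  assumes k: "k \<ge> 1" and N: "2 * k < N" and S: "S \<subseteq> nsets {1..N} k"
    and sep: "separates S {1..N}"
  shows "determining_set (kneser_graph N k) S"
  unfolding determining_set_def verts_kneser
proof (intro conjI ballI impI S)
  fix g h A assume g: "g \<in> graph_automorphisms (kneser_graph N k)"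
    and h: "h \<in> graph_automorphisms (kneser_graph N k)"
    and eq: "\<forall>s\<in>S. g s = h s" and A: "A \<in> nsets {1..N} k"
  obtain \<sigma> where \<sigma>: "bij_betw \<sigma> {1..N} {1..N}" "\<forall>A\<in>nsets {1..N} k. g A = \<sigma> ` A"
    using kneser_automorphism_induced[OF k N g] by (elim exE conjE)
  obtain \<tau> where \<tau>: "bij_betw \<tau> {1..N} {1..N}" "\<forall>A\<in>nsets {1..N} k. h A = \<tau> ` A"
    using kneser_automorphism_induced[OF k N h] by (elim exE conjE)
  have "\<sigma> x = \<tau> x" if x: "x \<in> {1..N}" for x
  proof -
    have "\<sigma> x \<in> \<tau> ` {1..N}" using \<sigma>(1) \<tau>(1) x by (auto simp: bij_betw_def)
    then obtain y where y: "y \<in> {1..N}" "\<sigma> x = \<tau> y" by blast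
    have "x = y"
    proof (rule separatesD[OF sep x y(1)])
      fix s assume s: "s \<in> S"
      then have sV: "s \<in> nsets {1..N} k" "s \<subseteq> {1..N}" using S by (auto simp: nsets_def)
      have "x \<in> s \<longleftrightarrow> \<sigma> x \<in> \<sigma> ` s"
        using inj_on_image_mem_iff[OF bij_betw_imp_inj_on[OF \<sigma>(1)] x sV(2)] by simp
      also have "\<sigma> ` s = \<tau> ` s" using eq s bspec[OF \<sigma>(2) sV(1)] bspec[OF \<tau>(2) sV(1)] by simp
      also have "\<sigma> x \<in> \<tau> ` s \<longleftrightarrow> y \<in> s"
        unfolding y(2) using inj_on_image_mem_iff[OF bij_betw_imp_inj_on[OF \<tau>(1)] y(1) sV(2)] by simp
      finally show "x \<in> s \<longleftrightarrow> y \<in> s" .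
    qed
    then show ?thesis using y by simp
  qed
  then have "\<sigma> ` A = \<tau> ` A" using A by (intro image_cong) (auto simp: nsets_def)
  then show "g A = h A" using bspec[OF \<sigma>(2) A] bspec[OF \<tau>(2) A] by simp
qed

lemma determining_number_le:
  assumes "k \<ge> 1" "2 * k < N" "S \<subseteq> nsets {1..N} k" "separates S {1..N}"
  shows "determining_number (kneser_graph N k) \<le> card S"
proof -
  have "finite S" using assms(3) finite_imp_finite_nsets by (rule finite_subset) simp
  then show ?thesis
    unfolding determining_number_def
    using separates_imp_determining_set[OF assms] by (intro Least_le) blast
qed

lemma determining_number_attained:
  assumes "k \<ge> 1" "k < N"
  shows "\<exists>S \<subseteq> nsets {1..N} k. separates S {1..N} \<and> card S = determining_number (kneser_graph N k)"
proof -
  let ?V = "nsets {1..N} k"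
  let ?P = "\<lambda>m. \<exists>S. finite S \<and> determining_set (kneser_graph N k) S \<and> card S = m"
  have "finite ?V" by (simp add: finite_imp_finite_nsets)
  moreover have "determining_set (kneser_graph N k) ?V"
    unfolding determining_set_def verts_kneser by (intro conjI subset_refl ballI impI) (erule (1) bspec)
  ultimately have "?P (card ?V)" by (intro exI[of _ ?V] conjI refl)
  then have "?P (determining_number (kneser_graph N k))"
    unfolding determining_number_def by (rule LeastI)
  then obtain S where S: "determining_set (kneser_graph N k) S"
      "card S = determining_number (kneser_graph N k)" by (elim exE conjE)
  have "S \<subseteq> ?V" using S(1) by (simp add: determining_set_def verts_kneser)
  then show ?thesis using S(2) determining_set_imp_separates[OF assms S(1)]
    by (intro exI[of _ S] conjI)
qed

section \<open>The size of separating families\<close>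

text \<open>
  In a separating family few points are covered rarely: at most one lies in no member, and points lying in exactly one member have different ones, so there
  are at most \<open>card S\<close> of them. All other points contribute at least \<open>2\<close> to the number
  \<open>card S * k\<close> of incidences.
\<close>

lemma separating_family_lower_bound:
  assumes X: "finite X" and S: "S \<subseteq> nsets X k" and sep: "separates S X"
  shows "2 * card X \<le> card S * (k + 1) + 2"
proof -
  have finS: "finite S" using S finite_imp_finite_nsets[OF X] by (rule finite_subset)
  define d where "d x = card {A \<in> S. x \<in> A}" for x
  let ?X0 = "{x \<in> X. d x = 0}"
  let ?X1 = "{x \<in> X. d x = 1}"
  have d0: "{A \<in> S. x \<in> A} = {}" if "d x = 0" for x using that finS by (simp add: d_def)
  have "x = y" if "x \<in> ?X0" "y \<in> ?X0" for x y
    using that d0[of x] d0[of y] by (intro separatesD[OF sep]) auto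
  then have c0: "card ?X0 \<le> 1" using X by (auto simp: card_le_Suc0_iff_eq)
  have "\<forall>x\<in>?X1. \<exists>A. {A \<in> S. x \<in> A} = {A}"
    by (auto simp: d_def card_1_singleton_iff)
  then obtain e where e: "\<And>x. x \<in> ?X1 \<Longrightarrow> {A \<in> S. x \<in> A} = {e x}" by metis
  have "inj_on e ?X1"
  proof (rule inj_onI)
    fix x y assume xy: "x \<in> ?X1" "y \<in> ?X1" "e x = e y"
    then have "{A \<in> S. x \<in> A} = {A \<in> S. y \<in> A}" using e by metis
    then show "x = y" using xy by (intro separatesD[OF sep]) auto
  qed
  moreover have "e ` ?X1 \<subseteq> S" using e by blast
  ultimately have c1: "card ?X1 \<le> card S" using finS by (metis card_inj_on_le)
  have "(\<Sum>x\<in>X. d x) = (\<Sum>A\<in>S. card {x \<in> X. x \<in> A})"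
    unfolding d_def by (rule sum_multicount_gen[OF X finS]) simp
  also have "\<dots> = (\<Sum>A\<in>S. k)"
  proof (rule sum.cong)
    fix A assume "A \<in> S"
    then have "A \<subseteq> X" "card A = k" using S by (auto simp: nsets_def)
    moreover from this have "{x \<in> X. x \<in> A} = A" by blast
    ultimately show "card {x \<in> X. x \<in> A} = k" by simp
  qed simp
  finally have sumd: "(\<Sum>x\<in>X. d x) = card S * k" by simp
  \<comment> \<open>Points of degree 0 and 1 are short of 2 by 2 and 1.\<close>
  have "2 * card X = (\<Sum>x\<in>X. 2)" by simp
  also have "\<dots> \<le> (\<Sum>x\<in>X. d x + 2 * (if d x = 0 then 1 else 0) + (if d x = 1 then 1 else 0))"
    by (rule sum_mono) auto
  also have "\<dots> = card S * k + 2 * card ?X0 + card ?X1"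
    using X by (simp add: sum.distrib sumd sum.If_cases sum_distrib_left[symmetric] Int_def)
  finally show ?thesis using c0 c1 by simp
qed

definition separating_family_of_size :: "nat \<Rightarrow> nat \<Rightarrow> nat \<Rightarrow> bool" where
  "separating_family_of_size N k m \<longleftrightarrow>
    (\<exists>S \<subseteq> nsets {1..N} k. separates S {1..N} \<and> card S = m)"

text \<open>
  The additional set consists of the new point and part of some member \<open>A0\<close>. The new point lies
  in no other set, and any old point sharing the additional set with it also lies in \<open>A0\<close>.
\<close>

lemma separating_family_of_size_add_point:
  assumes fam: "separating_family_of_size N k m" and "k \<ge> 1" "m \<ge> 1"
  shows "separating_family_of_size (Suc N) k (Suc m)"
proof -
  obtain S where S: "S \<subseteq> nsets {1..N} k" "separates S {1..N}" "card S = m"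
    using fam by (auto simp: separating_family_of_size_def)
  have finS: "finite S" using S(1) finite_imp_finite_nsets by (rule finite_subset) simp
  have SN: "A \<subseteq> {1..N}" "card A = k" "finite A" if "A \<in> S" for A
    using that S(1) by (auto simp: nsets_def)
  have "S \<noteq> {}" using assms(3) S(3) by auto
  then obtain A0 where A0: "A0 \<in> S" by blast
  then have "k - 1 \<le> card A0" using SN by simp
  then obtain C where C: "C \<subseteq> A0" "card C = k - 1" "finite C"
    by (rule obtain_subset_with_card_n)
  let ?T = "insert (Suc N) C"
  have fresh: "Suc N \<notin> A" if "A \<in> S" for A using SN(1)[OF that] by auto
  have T: "?T \<in> nsets {1..Suc N} k" "?T \<notin> S"
    using C SN(1)[OF A0] fresh[OF A0] fresh assms(2)
    by (auto simp: nsets_def card_insert_if)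
  have new: "x = Suc N" if "x \<in> {1..Suc N}" "\<And>A. A \<in> insert ?T S \<Longrightarrow> x \<in> A \<longleftrightarrow> Suc N \<in> A" for x
  proof (rule ccontr)
    assume "x \<noteq> Suc N"
    then have "x \<in> A0" using that(2)[of ?T] C by auto
    then show False using that(2)[of A0] A0 fresh by auto
  qed
  have "separates (insert ?T S) {1..Suc N}"
    unfolding separates_def
  proof (intro ballI impI)
    fix x y assume xy: "x \<in> {1..Suc N}" "y \<in> {1..Suc N}"
      and same: "\<forall>A\<in>insert ?T S. x \<in> A \<longleftrightarrow> y \<in> A"
    consider "x = Suc N" | "y = Suc N" | "x \<in> {1..N}" "y \<in> {1..N}" using xy by fastforce
    then show "x = y"
    proof cases
      case 1 then show ?thesis using new[of y] xy same by auto
    next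
      case 2 then show ?thesis using new[of x] xy same by auto
    next
      case 3 then show ?thesis using same by (intro separatesD[OF S(2)]) auto
    qed
  qed
  moreover have "insert ?T S \<subseteq> nsets {1..Suc N} k"
    using T S(1) nsets_mono[of "{1..N}" "{1..Suc N}" k] by auto
  moreover have "card (insert ?T S) = Suc m" using T finS S(3) by simp
  ultimately show ?thesis unfolding separating_family_of_size_def by blast
qed

text \<open>
  To raise the size of the sets, one new point \<open>p\<close> is put into every member, while the other new
  point \<open>q\<close> is put into none. Then \<open>p\<close> can be confused only with an old point lying in all members
  and \<open>q\<close> only with one lying in none. There is at most one of each kind, and the additional set,
  which contains \<open>p\<close> and \<open>q\<close>, avoids both; \<open>p\<close> and \<open>q\<close> are told apart by the old members.
\<close>

lemma separating_family_of_size_add_two_points: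
  assumes fam: "separating_family_of_size N k m" and "k \<ge> 1" "m \<ge> 1" "k + 1 \<le> N"
  shows "separating_family_of_size (N + 2) (Suc k) (Suc m)"
proof -
  obtain S where S: "S \<subseteq> nsets {1..N} k" "separates S {1..N}" "card S = m"
    using fam by (auto simp: separating_family_of_size_def)
  have finS: "finite S" using S(1) finite_imp_finite_nsets by (rule finite_subset) simp
  have SN: "A \<subseteq> {1..N}" "card A = k" "finite A" if "A \<in> S" for A
    using that S(1) by (auto simp: nsets_def)
  have "S \<noteq> {}" using assms(3) S(3) by auto
  define p where "p = N + 1"
  define q where "q = N + 2"
  have pq: "p \<noteq> q" "p \<notin> {1..N}" "q \<notin> {1..N}" by (auto simp: p_def q_def)
  let ?Z = "{x \<in> {1..N}. \<forall>A\<in>S. x \<notin> A}"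
  let ?W = "{x \<in> {1..N}. \<forall>A\<in>S. x \<in> A}"
  have "x = y" if "x \<in> ?Z" "y \<in> ?Z" for x y
    using that by (intro separatesD[OF S(2)]) auto
  then have "card ?Z \<le> 1" by (auto simp: card_le_Suc0_iff_eq)
  moreover have "x = y" if "x \<in> ?W" "y \<in> ?W" for x y
    using that by (intro separatesD[OF S(2)]) auto
  then have "card ?W \<le> 1" by (auto simp: card_le_Suc0_iff_eq)
  ultimately have "card (?Z \<union> ?W) \<le> 2" using card_Un_le[of ?Z ?W] by simp
  then have "k - 1 \<le> card ({1..N} - (?Z \<union> ?W))"
    using assms(4) diff_card_le_card_Diff[of "?Z \<union> ?W" "{1..N}"] by simp
  then obtain C where C: "C \<subseteq> {1..N} - (?Z \<union> ?W)" "card C = k - 1" "finite C"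
    by (rule obtain_subset_with_card_n)
  have CN: "C \<subseteq> {1..N}" using C by blast
  let ?T = "insert p (insert q C)"
  let ?S = "insert ?T (insert p ` S)"
  have inj: "inj_on (insert p) S"
  proof (rule inj_onI)
    fix A B assume "A \<in> S" "B \<in> S" "insert p A = insert p B"
    then show "A = B" using SN(1) pq by (metis Diff_insert_absorb subsetD insert_ident)
  qed
  have qS: "q \<notin> insert p A" if "A \<in> S" for A using SN(1)[OF that] pq by auto
  have T: "?T \<notin> insert p ` S" using qS by blast
  have mem: "x \<in> {1..N} \<Longrightarrow> x \<in> insert p A \<longleftrightarrow> x \<in> A" for x A using pq by auto
  have pnew: "x = p" if x: "x \<in> {1..N} \<union> {p, q}"
    and same: "\<And>A. A \<in> ?S \<Longrightarrow> x \<in> A \<longleftrightarrow> p \<in> A" for x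
  proof (rule ccontr)
    assume "x \<noteq> p"
    have "x \<in> A" if "A \<in> S" for A using same[of "insert p A"] that \<open>x \<noteq> p\<close> by auto
    moreover from this have "x \<noteq> q" using qS \<open>S \<noteq> {}\<close> by blast
    ultimately have "x \<in> ?W" using x \<open>x \<noteq> p\<close> by auto
    moreover have "x \<in> C" using same[of ?T] \<open>x \<noteq> p\<close> \<open>x \<noteq> q\<close> by auto
    ultimately show False using C by blast
  qed
  have qnew: "x = q" if x: "x \<in> {1..N} \<union> {p, q}"
    and same: "\<And>A. A \<in> ?S \<Longrightarrow> x \<in> A \<longleftrightarrow> q \<in> A" for x
  proof (rule ccontr)
    assume "x \<noteq> q"
    have no: "x \<notin> insert p A" if "A \<in> S" for A using same[of "insert p A"] that qS by auto
    then have "x \<noteq> p" using \<open>S \<noteq> {}\<close> by blast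
    then have "x \<in> ?Z" using x \<open>x \<noteq> q\<close> no by auto
    moreover have "x \<in> C" using same[of ?T] \<open>x \<noteq> p\<close> \<open>x \<noteq> q\<close> by auto
    ultimately show False using C by blast
  qed
  have ground: "{1..N + 2} = {1..N} \<union> {p, q}" by (auto simp: p_def q_def)
  have "separates ?S {1..N + 2}"
    unfolding separates_def ground
  proof (intro ballI impI)
    fix x y assume xy: "x \<in> {1..N} \<union> {p, q}" "y \<in> {1..N} \<union> {p, q}"
      and same: "\<forall>A\<in>?S. x \<in> A \<longleftrightarrow> y \<in> A"
    have s: "x \<in> A \<longleftrightarrow> y \<in> A" if "A \<in> ?S" for A using same that by (rule bspec)
    consider "x = p" | "y = p" | "x = q" | "y = q" | "x \<in> {1..N}" "y \<in> {1..N}" using xy by blast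
    then show "x = y"
    proof cases
      case 1
      have "y = p" by (rule pnew[OF xy(2)]) (use 1 s in \<open>simp only:\<close>)
      then show ?thesis using 1 by simp
    next
      case 2
      have "x = p" by (rule pnew[OF xy(1)]) (use 2 s in \<open>simp only:\<close>)
      then show ?thesis using 2 by simp
    next
      case 3
      have "y = q" by (rule qnew[OF xy(2)]) (use 3 s in \<open>simp only:\<close>)
      then show ?thesis using 3 by simp
    next
      case 4
      have "x = q" by (rule qnew[OF xy(1)]) (use 4 s in \<open>simp only:\<close>)
      then show ?thesis using 4 by simp
    next
      case 5
      show ?thesis
      proof (rule separatesD[OF S(2) 5])
        fix A assume "A \<in> S"
        then have "x \<in> insert p A \<longleftrightarrow> y \<in> insert p A" by (intro s insertI2 imageI)
        then show "x \<in> A \<longleftrightarrow> y \<in> A" using mem[OF 5(1)] mem[OF 5(2)] by simp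
      qed
    qed
  qed
  moreover have "?S \<subseteq> nsets {1..N + 2} (Suc k)"
  proof -
    have "?T \<in> nsets {1..N + 2} (Suc k)"
    proof -
      have "p \<notin> insert q C" "q \<notin> C" using CN pq by auto
      then have "card ?T = Suc k" using C(2,3) assms(2) by simp
      then show ?thesis unfolding ground using CN C(3) by (auto simp: nsets_def)
    qed
    moreover have "insert p A \<in> nsets {1..N + 2} (Suc k)" if "A \<in> S" for A
    proof -
      have "p \<notin> A" using SN(1)[OF that] pq by auto
      then show ?thesis unfolding ground using SN[OF that] by (auto simp: nsets_def)
    qed
    ultimately show ?thesis by blast
  qed
  moreover have "card ?S = Suc m" using T finS S(3) card_image[OF inj] by simp
  ultimately show ?thesis unfolding separating_family_of_size_def by blast
qed

lemma separating_family_singletons: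
  assumes "N \<ge> 1"
  shows "separating_family_of_size N 1 (N - 1)"
proof -
  let ?S = "(\<lambda>x. {x}) ` {1..<N}"
  have "?S \<subseteq> nsets {1..N} 1" by (auto simp: nsets_def)
  moreover have "separates ?S {1..N}"
    unfolding separates_def
  proof (intro ballI impI)
    fix x y assume "x \<in> {1..N}" "y \<in> {1..N}" "\<forall>A\<in>?S. x \<in> A \<longleftrightarrow> y \<in> A"
    then show "x = y" by (cases "x < N"; cases "y < N") auto
  qed
  moreover have "card ?S = N - 1" by (simp add: card_image)
  ultimately show ?thesis unfolding separating_family_of_size_def by blast
qed

text \<open>
  Pairs are edges of a graph, and they separate when there is at most one isolated vertex and no
  isolated edge: here a path with four vertices and one isolated vertex.
\<close>

lemma separating_family_5_2: "separating_family_of_size 5 2 3"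
  unfolding separating_family_of_size_def
proof (intro exI conjI)
  let ?S = "{{1,2},{2,3},{3,4}} :: nat set set"
  show "?S \<subseteq> nsets {1..5} 2" by simp
  show "separates ?S {1..5}" unfolding separates_def by (auto simp: numeral_eq_Suc atLeastAtMostSuc_conv)
  show "card ?S = 3" by (simp add: doubleton_eq_iff card_insert_if)
qed

text \<open>
  A forest with \<open>c\<close> components has \<open>N - c\<close> edges. Seven is the first number of vertices that allows
  three components without an isolated edge or a second isolated vertex: two paths with three
  vertices each, and one isolated vertex.
\<close>

lemma separating_family_7_2: "separating_family_of_size 7 2 4"
  unfolding separating_family_of_size_def
proof (intro exI conjI)
  let ?S = "{{1,2},{2,3},{4,5},{5,6}} :: nat set set"
  show "?S \<subseteq> nsets {1..7} 2" by simp
  show "separates ?S {1..7}" unfolding separates_def by (auto simp: numeral_eq_Suc atLeastAtMostSuc_conv)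
  show "card ?S = 4" by (simp add: doubleton_eq_iff card_insert_if)
qed

text \<open>
  Seven of the eight possible incidence patterns with three sets occur, each at one point; leaving
  out the pattern of a point in all three sets brings each set down to size three.
\<close>

lemma separating_family_7_3: "separating_family_of_size 7 3 3"
  unfolding separating_family_of_size_def
proof (intro exI conjI)
  let ?S = "{{1,4,5},{2,4,6},{3,5,6}} :: nat set set"
  show "?S \<subseteq> nsets {1..7} 3" by (simp add: nsets_def)
  show "separates ?S {1..7}" unfolding separates_def by (auto simp: numeral_eq_Suc atLeastAtMostSuc_conv)
  show "card ?S = 3" by (simp add: set_eq_subset card_insert_if)
qed

lemma separating_family_odd:
  assumes "k \<ge> 3"
  shows "separating_family_of_size (2 * k + 1) k k"
  using assms
proof (induction k rule: dec_induct)
  case base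
  then show ?case using separating_family_7_3 by simp
next
  case (step k)
  then show ?case using separating_family_of_size_add_two_points[of "2 * k + 1" k k] by simp
qed

lemma separating_family_extend:
  assumes "separating_family_of_size N k m" "k \<ge> 1" "m \<ge> 1"
  shows "separating_family_of_size (N + i) k (m + i)"
  using assms by (induction i) (simp_all add: separating_family_of_size_add_point)

lemma separating_family_small:
  assumes "k \<ge> 2" "2 * k < N" "N \<ge> 7"
  shows "separating_family_of_size N k (N - k - 1)"
proof (cases "k = 2")
  case True
  then show ?thesis using separating_family_extend[OF separating_family_7_2, of "N - 7"] assms by simp
next
  case False
  then show ?thesis
    using separating_family_extend[OF separating_family_odd[of k], of "N - (2 * k + 1)"] assms by simp
qed

lemma determining_number_kneser_iff:
  assumes k: "k \<ge> 1" and N: "2 * k < N"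
  shows "determining_number (kneser_graph N k) = N - k \<longleftrightarrow> k = 1 \<or> k = 2 \<and> (N = 5 \<or> N = 6)"
    (is "?D = _ \<longleftrightarrow> _")
proof -
  have up: "?D \<le> m" if "separating_family_of_size N k m" for m
    using that determining_number_le[OF k N] by (auto simp: separating_family_of_size_def)
  have low: "2 * N \<le> ?D * (k + 1) + 2"
  proof -
    obtain S where S: "S \<subseteq> nsets {1..N} k" "separates S {1..N}" "card S = ?D"
      using determining_number_attained[of k N] k N by auto
    show ?thesis using separating_family_lower_bound[OF _ S(1,2)] S(3) by simp
  qed
  consider "k = 1" | "k = 2" "N = 5" | "k = 2" "N = 6" | "k \<ge> 2" "N \<ge> 7" using k N by linarith
  then show ?thesis
  proof cases
    case 1
    then show ?thesis using up[of "N - 1"] separating_family_singletons[of N] low N by simp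
  next
    case 2
    then show ?thesis using up[of 3] separating_family_5_2 low by simp
  next
    case 3
    then show ?thesis
      using up[of 4] separating_family_of_size_add_point[OF separating_family_5_2] low by simp
  next
    case 4
    then have "?D \<le> N - k - 1" using up separating_family_small[OF _ N] by simp
    then show ?thesis using 4 N by simp
  qed
qed

section \<open>Isomorphism with the exceptional graphs\<close>

lemma graph_isomorphic_refl:
  assumes "pair_wf_digraph G"
  shows "graph_isomorphic G G"
proof -
  let ?f = "\<lparr>iso_verts = id, iso_arcs = id, iso_head = snd, iso_tail = fst\<rparr>"
  have "pre_digraph.digraph_isomorphism (with_proj G) ?f"
    using assms by (simp add: pre_digraph.digraph_isomorphism_def wf_digraph_wp_iff)
  moreover have "with_proj G = app_iso ?f (with_proj G)"
    by (simp add: app_iso_def with_proj_def)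
  ultimately show ?thesis unfolding digraph_iso_def by blast
qed

lemma graph_isomorphic_card_verts:
  assumes "graph_isomorphic G H"
  shows "card (pverts H) = card (pverts G)"
proof -
  obtain f where f: "pre_digraph.digraph_isomorphism (with_proj G) f"
    "with_proj H = app_iso f (with_proj G)"
    using assms by (auto simp: digraph_iso_def)
  have "pverts H = iso_verts f ` pverts G"
    using f(2) by (auto simp: app_iso_def with_proj_def)
  moreover have "inj_on (iso_verts f) (pverts G)"
    using f(1) by (simp add: pre_digraph.digraph_isomorphism_def)
  ultimately show ?thesis by (simp add: card_image)
qed

lemma exceptional_kneser_iff:
  assumes k: "k \<ge> 1" and N: "2 * k < N"
  shows "graph_isomorphic (kneser_graph N k) (kneser_graph N 1) \<or>
    graph_isomorphic (kneser_graph N k) (kneser_graph 5 2) \<or>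
    graph_isomorphic (kneser_graph N k) (kneser_graph 6 2) \<longleftrightarrow>
    k = 1 \<or> k = 2 \<and> (N = 5 \<or> N = 6)" (is "?L \<longleftrightarrow> ?R")
proof
  interpret pair_graph "kneser_graph N k" by (rule pair_graph_kneser_graph[OF k])
  assume ?R
  then show ?L using graph_isomorphic_refl[OF pair_wf_digraph_axioms] by auto
next
  assume ?L
  then have c: "N choose k = N \<or> N choose k = 10 \<or> N choose k = 15"
    by (auto dest!: graph_isomorphic_card_verts simp: verts_kneser card_nsets choose_two)
  show ?R
  proof (rule ccontr)
    assume "\<not> ?R"
    then have k2: "k \<ge> 2" "N \<ge> 7" using k N by auto
    have "N < N choose k" using binomial_strict_mono[of 1 k N] k2 N by simp
    moreover have "N choose 2 \<le> N choose k" using k2 N by (intro binomial_mono) auto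
    moreover have "7 choose 2 \<le> N choose 2" using k2 by (intro binomial_right_mono)
    ultimately show False using c by (simp add: choose_two)
  qed
qed

theorem theorem5p2:
  fixes n k :: nat
  assumes "k \<ge> 1" and "n + 1 > 2 * k"
  shows "determining_number (kneser_graph (n + 1) k) = n + 1 - k \<longleftrightarrow>
    graph_isomorphic (kneser_graph (n + 1) k) (kneser_graph (n + 1) 1) \<or>
    graph_isomorphic (kneser_graph (n + 1) k) (kneser_graph 5 2) \<or>
    graph_isomorphic (kneser_graph (n + 1) k) (kneser_graph 6 2)"
  using determining_number_kneser_iff[of k "n + 1"] exceptional_kneser_iff[of k "n + 1"] assms
  by simp

end
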